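(* Let $k>1$ be an integer and let $M_1(1)=\bigoplus_{l=0}^{k-1}M_1^{(l)}(1)$ be the eigenspace decomposition of the one-dimensional Heisenberg vertex operator algebra under the automorphism $g$ of order $k$ which multiplies every element $\alpha(-n_1)\cdots\alpha(-n_l)\mathbf 1$ of $\alpha$-length $l$ by $e^{2\pi i l/k}$. Then for any set $\{l_1,\dots,l_s\}$ of distinct integers with $1\le l_r\le k-1$ for all $1\le r\le s$, the subspace $$M:=\bigoplus_{r=1}^sM_1^{(l_r)}(1)$$ is a Mathieu-Zhao subspace of $M_1(1)$.
   Context: The one-dimensional Heisenberg vertex operator algebra $M_1(1)$: let $\mathbf h=\mathbb C\alpha$ with symmetric bilinear form $\langle\alpha,\alpha\rangle=1$, viewed as an abelian Lie algebra, and $\hat{\mathbf h}=\mathbf h\otimes\mathbb C[t,t^{-1}]\oplus\mathbb Cc$ with $c$ central and, writing $\alpha(n)=\alpha\otimes t^n$, $[\alpha(m),\alpha(n)]=m\delta_{m+n,0}c$. $M_1(1)=U(\hat{\mathbf h})\otimes_{U(\mathbf h\otimes\mathbb C[t]\oplus\mathbb Cc)}\mathbb C$, where $\mathbf h\otimes\mathbb C[t]$ acts as $0$ on $\mathbb C$ and $c$ acts as $1$; the vacuum is $\mathbf 1=1$. So $\alpha(n)\mathbf 1=0$ for $n\ge0$ and $M_1(1)$ has as basis the monomials $\alpha(-n_1)\cdots\alpha(-n_d)\mathbf 1$ with $d\ge0$, $n_1\ge\dots\ge n_d\ge1$. With $\alpha(z)=\sum_{n\in\mathbb Z}\alpha(n)z^{-n-1}$,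 the vertex operator of $v=\alpha(-n_1)\cdots\alpha(-n_d)\mathbf 1$ is the normally ordered product (modes $\alpha(n)$ with $n<0$ to the left of modes with $n\ge0$) of the fields $\frac1{(n_j-1)!}\big(\frac d{dz}\big)^{n_j-1}\alpha(z)$, $1\le j\le d$, extended linearly; write $Y(v,z)=\sum_{n\in\mathbb Z}v(n)z^{-n-1}$. The element $\alpha(-n_1)\cdots\alpha(-n_d)\mathbf 1$ ($n_j\ge1$) has $\alpha$-length $d$, and $M_1^d(1)$ denotes the span of all elements of $\alpha$-length $d$ (with $M_1^0(1)=\mathbb C\mathbf 1$ and $M_1^d(1)=0$ for $d<0$). For $0\le l\le k-1$, $M_1^{(l)}(1)=\bigoplus_{m\in\mathbb Z}M_1^{l+km}(1)$. For a subspace $M$ of a vertex algebra $(V,Y,\mathbf 1)$ define: - the radical $\mathfrak r(M)$: the set of $v\in V$ for which there exists $m\ge1$ such that $v(n_1)\cdots v(n_t)\mathbf 1\in M$ for all $t\ge m$ and all $n_1,\dots,n_t\in\mathbb Z$; - the left strong radical $l\mathfrak{sr}(M)$: the set of $v\in V$ for which there exists $m\ge1$ such that $b(s)v(n_1)\cdots v(n_t)\mathbf 1\in M$ for all $t\ge m$, $b\in V$, $s,n_1,\dots,n_t\in\mathbb Z$; - the right strong radical $r\mathfrak{sr}(M)$: the set of $v\in V$ for which there exists $m\ge1$ such that $\big(v(n_1)\cdots v(n_t)\mathbf 1\big)(n)w\in M$ for all $t\ge m$, $w\in V$, $n,n_1,\dots,n_t\in\mathbb Z$; - the strong radical $\mathfrak{sr}(M)=l\mathfrak{sr}(M)\cap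 r\mathfrak{sr}(M)$. $M$ is a Mathieu-Zhao subspace of $V$ if $\mathfrak r(M)=\mathfrak{sr}(M)$. *)

theory Defs
  imports "HOL-Analysis.Complex_Transcendental" "HOL-Library.Poly_Mapping" "HOL-Library.Multiset"
begin

section \<open>The one-dimensional Heisenberg module\<close>

text \<open>The Heisenberg Lie algebra has the basis \<open>\<alpha>(n)\<close> (\<open>n \<in> \<int>\<close>) together with the central
  element \<open>c\<close>. All brackets are multiples of \<open>c\<close>; \<open>bracket x y\<close> is the coefficient of \<open>c\<close>
  in the bracket of the basis elements \<open>x\<close> and \<open>y\<close>.\<close>

datatype heis_gen = Al int | Cc

fun bracket :: "heis_gen \<Rightarrow> heis_gen \<Rightarrow> complex" where
  "bracket (Al m) (Al n) = (if m + n = 0 then of_int m else 0)"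
| "bracket _ _ = 0"

text \<open>The tensor algebra of the Heisenberg Lie algebra is the free associative algebra on this
  basis: finitely supported complex functions on words, the product being concatenation.\<close>

type_synonym tensor_alg = "heis_gen list \<Rightarrow>\<^sub>0 complex"

abbreviation word :: "heis_gen list \<Rightarrow> tensor_alg" where
  "word w \<equiv> Poly_Mapping.single w 1"

definition tscale :: "complex \<Rightarrow> tensor_alg \<Rightarrow> tensor_alg" where
  "tscale a = Poly_Mapping.map ((*) a)"

lemma lookup_tscale [simp]: "Poly_Mapping.lookup (tscale a p) w = a * Poly_Mapping.lookup p w"
  by (simp add: tscale_def Poly_Mapping.map.rep_eq when_def)

global_interpretation tens: vector_space tscale
  by unfold_locales (auto intro!: poly_mapping_eqI simp: lookup_add algebra_simps)

text \<open>\<open>M\<^sub>1(1) = U \<otimes>\<^bsub>U(b)\<^esub> \<complex>\<close> is the quotient of the tensor algebra by the span of the elements below.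
  The first set spans the two-sided ideal that cuts out the enveloping algebra \<open>U\<close>. The other
  two express \<open>u x \<otimes> 1 = u \<otimes> x 1\<close> for the basis elements \<open>x\<close> of \<open>b\<close>, the span of \<open>c\<close> and the
  \<open>\<alpha>(n)\<close> with \<open>n \<ge> 0\<close>.\<close>

definition heis_rels :: "tensor_alg set" where
  "heis_rels =
     {word (u @ [x, y] @ w) - word (u @ [y, x] @ w) - tscale (bracket x y) (word (u @ [Cc] @ w))
        | u x y w. True}
   \<union> {word (u @ [Al n]) | u n. n \<ge> 0}
   \<union> {word (u @ [Cc]) - word u | u. True}"

quotient_type heis = tensor_alg / "\<lambda>p q. p - q \<in> tens.span heis_rels"
proof (rule equivpI)
  show "reflp (\<lambda>p q. p - q \<in> tens.span heis_rels)"
    by (auto intro!: reflpI tens.span_zero)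
  show "symp (\<lambda>p q. p - q \<in> tens.span heis_rels)"
  proof (rule sympI)
    fix p q assume "p - q \<in> tens.span heis_rels"
    from tens.span_neg[OF this] show "q - p \<in> tens.span heis_rels" by simp
  qed
  show "transp (\<lambda>p q. p - q \<in> tens.span heis_rels)"
  proof (rule transpI)
    fix p q r assume "p - q \<in> tens.span heis_rels" "q - r \<in> tens.span heis_rels"
    from tens.span_add[OF this] show "p - r \<in> tens.span heis_rels" by simp
  qed
qed

instantiation heis :: ab_group_add
begin

lift_definition zero_heis :: heis is 0 .

lift_definition plus_heis :: "heis \<Rightarrow> heis \<Rightarrow> heis" is "(+)"
  by (drule (1) tens.span_add) (simp add: algebra_simps)

lift_definition uminus_heis :: "heis \<Rightarrow> heis" is uminus
  by (drule tens.span_neg) (simp add: algebra_simps)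

lift_definition minus_heis :: "heis \<Rightarrow> heis \<Rightarrow> heis" is "(-)"
  by (drule (1) tens.span_diff) (simp add: algebra_simps)

instance
  by standard (transfer, simp add: algebra_simps tens.span_zero)+

end

lift_definition hscale :: "complex \<Rightarrow> heis \<Rightarrow> heis" is tscale
  by (drule tens.span_scale) (simp add: tens.scale_right_diff_distrib)

global_interpretation heis: vector_space hscale
  by unfold_locales (transfer; simp add: tens.scale_right_distrib tens.scale_left_distrib tens.span_zero)+

lift_definition lmul :: "heis_gen \<Rightarrow> tensor_alg \<Rightarrow> tensor_alg" is
  "\<lambda>x p w. case w of [] \<Rightarrow> 0 | y # w' \<Rightarrow> if y = x then p w' else 0"
proof -
  fix x and p :: "heis_gen list \<Rightarrow> complex"
  assume "finite {w. p w \<noteq> 0}"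
  then have "finite ((#) x ` {w. p w \<noteq> 0})" by simp
  moreover have "{w. (case w of [] \<Rightarrow> 0 | y # w' \<Rightarrow> if y = x then p w' else 0) \<noteq> 0}
      \<subseteq> (#) x ` {w. p w \<noteq> 0}"
  proof
    fix w assume "w \<in> {w. (case w of [] \<Rightarrow> 0 | y # w' \<Rightarrow> if y = x then p w' else 0) \<noteq> 0}"
    then show "w \<in> (#) x ` {w. p w \<noteq> 0}" by (cases w) (auto split: if_splits)
  qed
  ultimately show "finite {w. (case w of [] \<Rightarrow> 0 | y # w' \<Rightarrow> if y = x then p w' else 0) \<noteq> 0}"
    by (rule finite_subset[rotated])
qed

lemma lmul_word [simp]: "lmul x (word w) = word (x # w)"
  by (rule poly_mapping_eqI) (auto simp: lmul.rep_eq lookup_single when_def split: list.splits)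

lemma lmul_add: "lmul x (p + q) = lmul x p + lmul x q"
  by (rule poly_mapping_eqI) (auto simp: lmul.rep_eq lookup_add split: list.splits)

lemma lmul_diff: "lmul x (p - q) = lmul x p - lmul x q"
  by (rule poly_mapping_eqI) (auto simp: lmul.rep_eq lookup_minus split: list.splits)

lemma lmul_tscale: "lmul x (tscale a p) = tscale a (lmul x p)"
  by (rule poly_mapping_eqI) (auto simp: lmul.rep_eq split: list.splits)

lemma lmul_zero [simp]: "lmul x 0 = 0"
  by (rule poly_mapping_eqI) (auto simp: lmul.rep_eq split: list.splits)

lemma lmul_heis_rels: "p \<in> heis_rels \<Longrightarrow> lmul x p \<in> heis_rels"
  unfolding heis_rels_def
  apply (elim UnE CollectE exE conjE)
  subgoal for u a b w
    by (rule UnI1, rule UnI1, rule CollectI, rule exI[of _ "x # u"])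
       (auto simp: lmul_diff lmul_tscale)
  subgoal for u n
    by (rule UnI1, rule UnI2, rule CollectI, rule exI[of _ "x # u"]) auto
  subgoal for u
    by (rule UnI2, rule CollectI, rule exI[of _ "x # u"]) (auto simp: lmul_diff)
  done

lemma lmul_span: "p \<in> tens.span heis_rels \<Longrightarrow> lmul x p \<in> tens.span heis_rels"
proof (induction rule: tens.span_induct_alt)
  case base
  then show ?case by (simp add: tens.span_zero)
next
  case (step c q p)
  then show ?case
    by (simp add: lmul_add lmul_tscale tens.span_add tens.span_scale tens.span_base lmul_heis_rels)
qed

lift_definition alpha :: "int \<Rightarrow> heis \<Rightarrow> heis" is "\<lambda>n. lmul (Al n)"
  by (drule lmul_span) (simp add: lmul_diff)

lift_definition vac :: heis is "word []" .

text \<open>\<open>hmon [n\<^sub>1, \<dots>, n\<^sub>d]\<close> is the element \<open>\<alpha>(-n\<^sub>1) \<cdots> \<alpha>(-n\<^sub>d) 1\<close>.\<close>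

definition hmon :: "nat list \<Rightarrow> heis" where
  "hmon ns = foldr (\<lambda>n. alpha (- int n)) ns vac"

definition positive :: "nat list \<Rightarrow> bool" where
  "positive ns \<longleftrightarrow> (\<forall>n \<in> set ns. n \<ge> 1)"


section \<open>Vertex operators\<close>

text \<open>Since \<open>(d/dz)\<^sup>j z\<^sup>p / j! = (p gchoose j) z\<^sup>p\<^sup>-\<^sup>j\<close>, the \<open>j\<close>-th field of \<open>\<alpha>(-n\<^sub>1) \<cdots> \<alpha>(-n\<^sub>d) 1\<close> is the
  sum over \<open>m\<close> of \<open>field_coeff n\<^sub>j m \<alpha>(m)\<close> times the power of \<open>z\<close> with exponent \<open>-m - n\<^sub>j\<close>.\<close>

definition field_coeff :: "nat \<Rightarrow> int \<Rightarrow> complex" where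
  "field_coeff n m = of_int (- m - 1) gchoose (n - 1)"

definition normal_order :: "int list \<Rightarrow> int list" where
  "normal_order ms = filter (\<lambda>m. m < 0) ms @ filter (\<lambda>m. m \<ge> 0) ms"

definition nop_term :: "nat list \<Rightarrow> int list \<Rightarrow> heis \<Rightarrow> heis" where
  "nop_term ns ms w =
     hscale (\<Prod>(n, m) \<leftarrow> zip ns ms. field_coeff n m) (foldr alpha (normal_order ms) w)"

text \<open>The coefficient of \<open>z\<^sup>-\<^sup>p\<^sup>-\<^sup>1\<close> in the normally ordered product of these fields, applied to \<open>w\<close>;
  only finitely many terms are nonzero (lemma \<open>finite_nop_support\<close>).\<close>

definition nop_support :: "nat list \<Rightarrow> int \<Rightarrow> heis \<Rightarrow> int list set" where
  "nop_support ns p w =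
     {ms. length ms = length ns \<and> sum_list ms + int (sum_list ns) = p + 1 \<and> nop_term ns ms w \<noteq> 0}"

definition nop_mode :: "nat list \<Rightarrow> int \<Rightarrow> heis \<Rightarrow> heis" where
  "nop_mode ns p w = (\<Sum>ms \<in> nop_support ns p w. nop_term ns ms w)"

text \<open>\<open>is_heis_mode Y\<close> says that \<open>Y v p w\<close> is \<open>v(p) w\<close>: linear in \<open>v\<close> and as prescribed on the
  monomial basis. There is exactly one such \<open>Y\<close> (lemma \<open>ex1_heis_mode\<close>).\<close>

definition is_heis_mode :: "(heis \<Rightarrow> int \<Rightarrow> heis \<Rightarrow> heis) \<Rightarrow> bool" where
  "is_heis_mode Y \<longleftrightarrow>
     (\<forall>p w. Vector_Spaces.linear hscale hscale (\<lambda>v. Y v p w)) \<and>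
     (\<forall>ns. positive ns \<and> sorted_wrt (\<ge>) ns \<longrightarrow> Y (hmon ns) = nop_mode ns)"

definition heis_mode :: "heis \<Rightarrow> int \<Rightarrow> heis \<Rightarrow> heis" where
  "heis_mode = (THE Y. is_heis_mode Y)"


section \<open>Grading by length\<close>

definition length_space :: "int \<Rightarrow> heis set" where
  "length_space d = heis.span {hmon ns | ns. positive ns \<and> int (length ns) = d}"

definition residue_space :: "int \<Rightarrow> int \<Rightarrow> heis set" where
  "residue_space k l = heis.span (\<Union>m. length_space (l + k * m))"

text \<open>\<open>g\<close> is the linear automorphism whose eigenspaces are the residue spaces (theorem
  \<open>residue_space_eigenspace\<close>); for \<open>k > 2\<close> it does not respect the products, as \<open>\<alpha>(1) \<alpha>(-1) 1 = 1\<close>.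
  The residue spaces decompose the module directly (theorems \<open>residue_space_sum\<close>,
  \<open>residue_space_direct\<close>).\<close>

definition is_length_rotation :: "int \<Rightarrow> (heis \<Rightarrow> heis) \<Rightarrow> bool" where
  "is_length_rotation k g \<longleftrightarrow>
     Vector_Spaces.linear hscale hscale g \<and>
     (\<forall>ns. positive ns \<longrightarrow>
        g (hmon ns) = hscale (exp (2 * of_real pi * \<i> * of_nat (length ns) / of_int k)) (hmon ns))"


section \<open>Radicals and Mathieu-Zhao subspaces\<close>

text \<open>In this section \<open>Y v n w\<close> is \<open>v(n) w\<close> and \<open>one\<close> is the vacuum of a vertex algebra;
  \<open>iter_mode Y v [n\<^sub>1, \<dots>, n\<^sub>t] one\<close> is \<open>v(n\<^sub>1) \<cdots> v(n\<^sub>t) 1\<close>.\<close>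

definition iter_mode :: "('v \<Rightarrow> int \<Rightarrow> 'v \<Rightarrow> 'v) \<Rightarrow> 'v \<Rightarrow> int list \<Rightarrow> 'v \<Rightarrow> 'v" where
  "iter_mode Y v ns w = foldr (Y v) ns w"

definition radical :: "('v \<Rightarrow> int \<Rightarrow> 'v \<Rightarrow> 'v) \<Rightarrow> 'v \<Rightarrow> 'v set \<Rightarrow> 'v set" where
  "radical Y one M =
     {v. \<exists>m\<ge>1. \<forall>ns. length ns \<ge> m \<longrightarrow> iter_mode Y v ns one \<in> M}"

definition left_strong_radical :: "('v \<Rightarrow> int \<Rightarrow> 'v \<Rightarrow> 'v) \<Rightarrow> 'v \<Rightarrow> 'v set \<Rightarrow> 'v set" where
  "left_strong_radical Y one M =
     {v. \<exists>m\<ge>1. \<forall>ns b s. length ns \<ge> m \<longrightarrow> Y b s (iter_mode Y v ns one) \<in> M}"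

definition right_strong_radical :: "('v \<Rightarrow> int \<Rightarrow> 'v \<Rightarrow> 'v) \<Rightarrow> 'v \<Rightarrow> 'v set \<Rightarrow> 'v set" where
  "right_strong_radical Y one M =
     {v. \<exists>m\<ge>1. \<forall>ns w n. length ns \<ge> m \<longrightarrow> Y (iter_mode Y v ns one) n w \<in> M}"

definition strong_radical :: "('v \<Rightarrow> int \<Rightarrow> 'v \<Rightarrow> 'v) \<Rightarrow> 'v \<Rightarrow> 'v set \<Rightarrow> 'v set" where
  "strong_radical Y one M = left_strong_radical Y one M \<inter> right_strong_radical Y one M"

definition mathieu_zhao ::
  "(complex \<Rightarrow> 'v::ab_group_add \<Rightarrow> 'v) \<Rightarrow> ('v \<Rightarrow> int \<Rightarrow> 'v \<Rightarrow> 'v) \<Rightarrow> 'v \<Rightarrow> 'v set \<Rightarrow> bool" where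
  "mathieu_zhao scl Y one M \<longleftrightarrow>
     module.subspace scl M \<and> radical Y one M = strong_radical Y one M"


section \<open>The monomial basis\<close>

lemma abs_heis_eq: "abs_heis p = abs_heis q \<longleftrightarrow> p - q \<in> tens.span heis_rels"
  by (rule heis.abs_eq_iff)

fun heis_act :: "heis_gen \<Rightarrow> heis \<Rightarrow> heis" where
  "heis_act (Al n) = alpha n"
| "heis_act Cc = id"

lemma word_Cc: "word (Cc # w) - word w \<in> tens.span heis_rels"
proof (induction w)
  case Nil
  have "word ([] @ [Cc]) - word [] \<in> heis_rels" unfolding heis_rels_def by blast
  then show ?case by (simp add: tens.span_base)
next
  case (Cons x w)
  have "word ([] @ [Cc, x] @ w) - word ([] @ [x, Cc] @ w)
      - tscale (bracket Cc x) (word ([] @ [Cc] @ w)) \<in> heis_rels"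
    unfolding heis_rels_def by blast
  then have "word (Cc # x # w) - word (x # Cc # w) \<in> tens.span heis_rels"
    by (simp add: tens.span_base)
  from tens.span_add[OF this lmul_span[OF Cons.IH, of x]] show ?case
    by (simp add: lmul_diff)
qed

lemma abs_heis_word: "abs_heis (word w) = foldr heis_act w vac"
proof (induction w)
  case Nil
  then show ?case by (simp add: vac_def)
next
  case (Cons x w)
  show ?case
  proof (cases x)
    case (Al n)
    have "abs_heis (word (x # w)) = alpha n (abs_heis (word w))"
      by (simp add: alpha.abs_eq Al)
    then show ?thesis by (simp add: Cons.IH Al)
  next
    case Cc
    then have "abs_heis (word (x # w)) = abs_heis (word w)"
      by (simp add: abs_heis_eq word_Cc)
    then show ?thesis by (simp add: Cons.IH Cc)
  qed
qed

lemma abs_heis_add: "abs_heis (p + q) = abs_heis p + abs_heis q"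
  by (simp add: plus_heis.abs_eq)

lemma abs_heis_zero: "abs_heis 0 = 0"
  by (simp add: zero_heis_def)

lemma abs_heis_tscale: "abs_heis (tscale a p) = hscale a (abs_heis p)"
  by (simp add: hscale.abs_eq)

lemma tensor_alg_in_span: "p \<in> tens.span (range word)"
proof -
  have "p = (\<Sum>w\<in>Poly_Mapping.keys p. tscale (Poly_Mapping.lookup p w) (word w))"
    by (rule poly_mapping_eqI)
       (auto simp: lookup_sum lookup_single when_def if_distrib in_keys_iff
             cong: if_cong)
  also have "\<dots> \<in> tens.span (range word)"
    by (intro tens.span_sum tens.span_scale tens.span_base) auto
  finally show ?thesis .
qed

lemma heis_words_span: "v \<in> heis.span (range (\<lambda>w. foldr heis_act w vac))"
proof -
  have "\<exists>p. v = abs_heis p" by (rule heis.abs_induct[of _ v]) blast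
  then obtain p where v: "v = abs_heis p" by blast
  have "abs_heis p \<in> heis.span (range (\<lambda>w. foldr heis_act w vac))"
    using tensor_alg_in_span[of p]
  proof (induction rule: tens.span_induct_alt)
    case base
    then show ?case by (simp add: abs_heis_zero heis.span_zero)
  next
    case (step c x y)
    then obtain w where "x = word w" by auto
    with step show ?case
      by (simp add: abs_heis_add abs_heis_tscale abs_heis_word
            heis.span_add heis.span_scale heis.span_base)
  qed
  then show ?thesis using v by simp
qed

lemma alpha_add: "alpha n (v + w) = alpha n v + alpha n w"
  by transfer (simp add: lmul_add tens.span_zero)

lemma alpha_hscale: "alpha n (hscale a v) = hscale a (alpha n v)"
  by transfer (simp add: lmul_tscale tens.span_zero)

lemma alpha_zero [simp]: "alpha n 0 = 0"
  using alpha_add[of n 0 0] by simp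

lemma alpha_vac: "n \<ge> 0 \<Longrightarrow> alpha n vac = 0"
proof transfer
  fix n :: int assume "n \<ge> 0"
  then have "word ([] @ [Al n]) \<in> heis_rels" unfolding heis_rels_def by blast
  then show "lmul (Al n) (word []) - 0 \<in> tens.span heis_rels"
    by (simp add: tens.span_base)
qed

lemma alpha_commute:
  "alpha m (alpha n v) = alpha n (alpha m v) + hscale (if m + n = 0 then of_int m else 0) v"
  using heis_words_span[of v]
proof (induction rule: heis.span_induct_alt)
  case base
  then show ?case by simp
next
  case (step c x y)
  then obtain w where w: "x = foldr heis_act w vac" by auto
  have "word ([] @ [Al m, Al n] @ w) - word ([] @ [Al n, Al m] @ w)
      - tscale (bracket (Al m) (Al n)) (word ([] @ [Cc] @ w)) \<in> heis_rels"
    unfolding heis_rels_def by blast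
  then have "word (Al m # Al n # w) -
      (word (Al n # Al m # w) + tscale (bracket (Al m) (Al n)) (word (Cc # w)))
      \<in> tens.span heis_rels"
    by (simp add: tens.span_base algebra_simps)
  then have "abs_heis (word (Al m # Al n # w)) =
      abs_heis (word (Al n # Al m # w) + tscale (bracket (Al m) (Al n)) (word (Cc # w)))"
    by (simp only: abs_heis_eq)
  then have "alpha m (alpha n x) = alpha n (alpha m x) + hscale (bracket (Al m) (Al n)) x"
    by (simp add: abs_heis_add abs_heis_tscale abs_heis_word w del: bracket.simps)
  with step.IH show ?case
    by (simp add: alpha_add alpha_hscale heis.scale_right_distrib heis.scale_left_commute algebra_simps)
qed

lemma alpha_hmon: "hmon (n # ns) = alpha (- int n) (hmon ns)"
  by (simp add: hmon_def)

lemma alpha_commute_same_sign: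
  "(m < 0 \<and> n < 0) \<or> (m \<ge> 0 \<and> n \<ge> 0) \<or> (m \<le> 0 \<and> n \<le> 0) \<Longrightarrow> alpha m (alpha n v) = alpha n (alpha m v)"
  by (subst alpha_commute) auto

lemma hmon_mset:
  assumes "mset ns = mset ns'"
  shows "hmon ns = hmon ns'"
proof -
  have "fold (\<lambda>n. alpha (- int n)) (rev ns) = fold (\<lambda>n. alpha (- int n)) (rev ns')"
    by (rule fold_multiset_equiv)
       (auto simp: fun_eq_iff assms intro!: alpha_commute_same_sign)
  then show ?thesis by (simp add: hmon_def foldr_conv_fold)
qed

lemma alpha_hmon_span:
  assumes "positive ns"
  shows "alpha n (hmon ns) \<in> heis.span {hmon ns | ns. positive ns}"
proof (cases "n < 0")
  case True
  then have "alpha n (hmon ns) = hmon (nat (- n) # ns)" by (simp add: alpha_hmon)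
  moreover have "positive (nat (- n) # ns)" using assms True by (auto simp: positive_def)
  ultimately show ?thesis by (metis (mono_tags, lifting) heis.span_base mem_Collect_eq)
next
  case False
  let ?S = "heis.span {hmon ns | ns. positive ns}"
  have step: "alpha m v \<in> ?S" if "m < 0" "v \<in> ?S" for m v
    using that(2)
  proof (induction rule: heis.span_induct_alt)
    case base
    then show ?case by (simp add: heis.span_zero)
  next
    case (step c x y)
    then obtain ns where ns: "x = hmon ns" "positive ns" by auto
    have "alpha m x = hmon (nat (- m) # ns)" using that by (simp add: alpha_hmon ns)
    moreover have "positive (nat (- m) # ns)" using ns that by (auto simp: positive_def)
    ultimately have "alpha m x \<in> ?S" by (metis (mono_tags, lifting) heis.span_base mem_Collect_eq)
    then show ?case using step by (simp add: alpha_add alpha_hscale heis.span_add heis.span_scale)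
  qed
  show ?thesis using assms
  proof (induction ns)
    case Nil
    then show ?case using False by (simp add: hmon_def alpha_vac heis.span_zero)
  next
    case (Cons a ns)
    then have pos: "positive ns" "a \<ge> 1" by (auto simp: positive_def)
    have "alpha n (hmon (a # ns)) = alpha (- int a) (alpha n (hmon ns))
        + hscale (if n + - int a = 0 then of_int n else 0) (hmon ns)"
      unfolding alpha_hmon by (rule alpha_commute)
    also have "\<dots> \<in> ?S"
      using pos by (intro heis.span_add heis.span_scale step Cons.IH)
        (auto intro: heis.span_base)
    finally show ?case .
  qed
qed

theorem hmon_span: "heis.span {hmon ns | ns. positive ns} = UNIV"
proof -
  let ?S = "heis.span {hmon ns | ns. positive ns}"
  have alph: "alpha n v \<in> ?S" if "v \<in> ?S" for n v
    using that
  proof (induction rule: heis.span_induct_alt)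
    case base
    then show ?case by (simp add: heis.span_zero)
  next
    case (step c x y)
    then obtain ns where "x = hmon ns" "positive ns" by auto
    then have "alpha n x \<in> ?S" using alpha_hmon_span by blast
    then show ?case using step by (simp add: alpha_add alpha_hscale heis.span_add heis.span_scale)
  qed
  have "positive []" by (simp add: positive_def)
  then have "hmon [] \<in> ?S" by (auto intro: heis.span_base)
  then have vacS: "vac \<in> ?S" by (simp add: hmon_def)
  have word: "foldr heis_act w vac \<in> ?S" for w
  proof (induction w)
    case (Cons x w)
    then show ?case by (cases x) (auto intro: alph)
  qed (simp add: vacS)
  have "heis.span (range (\<lambda>w. foldr heis_act w vac)) \<subseteq> ?S"
    using word by (intro heis.span_minimal heis.subspace_span) auto
  then show ?thesis using heis_words_span by blast
qed

text \<open>Linear independence of the monomials: the polynomial representation, on functions of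
  multisets. It yields the coordinates \<open>coord v A\<close> with respect to the monomials.\<close>

fun fock_op :: "heis_gen \<Rightarrow> (nat multiset \<Rightarrow> complex) \<Rightarrow> nat multiset \<Rightarrow> complex" where
  "fock_op (Al n) f A =
     (if n < 0 then (if nat (- n) \<in># A then f (A - {#nat (- n)#}) else 0)
      else of_int n * of_nat (Suc (count A (nat n))) * f (add_mset (nat n) A))"
| "fock_op Cc f A = f A"

definition fock_vac :: "nat multiset \<Rightarrow> complex" where
  "fock_vac A = (if A = {#} then 1 else 0)"

lemma fock_op_linear:
  "fock_op x (\<lambda>A. f A + c * g A) = (\<lambda>A. fock_op x f A + c * fock_op x g A)"
  by (cases x) (auto simp: fun_eq_iff algebra_simps)

lemma fock_word_linear:
  "foldr fock_op u (\<lambda>A. f A + c * g A) = (\<lambda>A. foldr fock_op u f A + c * foldr fock_op u g A)"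
  by (induction u) (auto simp: fock_op_linear)

lemma fock_op_zero: "fock_op x (\<lambda>A. 0) = (\<lambda>A. 0)"
  by (cases x) (auto simp: fun_eq_iff)

lemma fock_word_zero: "foldr fock_op u (\<lambda>A. 0) = (\<lambda>A. 0)"
  by (induction u) (auto simp: fock_op_zero)

lemma fock_op_commute:
  "fock_op x (fock_op y f) = (\<lambda>A. fock_op y (fock_op x f) A + bracket x y * f A)"
proof (cases x)
  case x: (Al m)
  show ?thesis
  proof (cases y)
    case y: (Al n)
    show ?thesis
    proof
      fix A
      consider "m < 0" "n < 0" | "m < 0" "n \<ge> 0" "m + n = 0" | "m < 0" "n \<ge> 0" "m + n \<noteq> 0"
        | "m \<ge> 0" "n < 0" "m + n = 0" | "m \<ge> 0" "n < 0" "m + n \<noteq> 0" | "m \<ge> 0" "n \<ge> 0"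
        by linarith
      then show "fock_op x (fock_op y f) A = fock_op y (fock_op x f) A + bracket x y * f A"
      proof cases
        case 1
        have "nat (- m) \<in># A - {#nat (- n)#} \<and> nat (- n) \<in># A \<longleftrightarrow>
              nat (- n) \<in># A - {#nat (- m)#} \<and> nat (- m) \<in># A"
          by (cases "m = n") (auto simp: in_diff_count split: if_splits)
        then show ?thesis using 1 by (auto simp: x y diff_diff_add_mset add_mset_commute)
      next
        case 2
        then have n: "n = - m" by simp
        show ?thesis
        proof (cases "nat (- m) \<in># A")
          case True
          then have "count A (nat (- m)) > 0" by simp
          with True show ?thesis using 2 by (auto simp: x y n algebra_simps of_nat_diff)
        next
          case False
          then have "count A (nat (- m)) = 0" by (simp add: not_in_iff)
          with False show ?thesis using 2 by (simp add: x y n)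
        qed
      next
        case 3
        then have "nat (- m) \<noteq> nat n" by auto
        then show ?thesis using 3 by (auto simp: x y)
      next
        case 4
        then have m: "m = - n" by simp
        show ?thesis
        proof (cases "nat (- n) \<in># A")
          case True
          then have "count A (nat (- n)) > 0" by simp
          with True show ?thesis using 4 by (auto simp: x y m algebra_simps of_nat_diff)
        next
          case False
          then have "count A (nat (- n)) = 0" by (simp add: not_in_iff)
          with False show ?thesis using 4 by (simp add: x y m)
        qed
      next
        case 5
        then have "nat (- n) \<noteq> nat m" by auto
        then show ?thesis using 5 by (auto simp: x y)
      next
        case 6
        then show ?thesis by (cases "m = n") (auto simp: x y add_mset_commute)
      qed
    qed
  qed (simp add: x fun_eq_iff)
qed (cases y; simp add: fun_eq_iff)

definition fock_eval :: "tensor_alg \<Rightarrow> nat multiset \<Rightarrow> complex" where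
  "fock_eval p A = (\<Sum>w\<in>Poly_Mapping.keys p. Poly_Mapping.lookup p w * foldr fock_op w fock_vac A)"

lemma fock_eval_superset:
  assumes "finite S" "Poly_Mapping.keys p \<subseteq> S"
  shows "fock_eval p A = (\<Sum>w\<in>S. Poly_Mapping.lookup p w * foldr fock_op w fock_vac A)"
  unfolding fock_eval_def
  by (rule sum.mono_neutral_left) (use assms in \<open>auto simp: in_keys_iff\<close>)

lemma fock_eval_word: "fock_eval (word w) = foldr fock_op w fock_vac"
  by (simp add: fock_eval_def fun_eq_iff)

lemma fock_eval_add: "fock_eval (p + q) A = fock_eval p A + fock_eval q A"
proof -
  let ?S = "Poly_Mapping.keys p \<union> Poly_Mapping.keys q"
  have "Poly_Mapping.keys (p + q) \<subseteq> ?S" by (rule Poly_Mapping.keys_add)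
  then show ?thesis
    by (simp add: fock_eval_superset[of ?S] lookup_add sum.distrib distrib_right)
qed

lemma fock_eval_tscale: "fock_eval (tscale c p) A = c * fock_eval p A"
proof -
  have "Poly_Mapping.keys (tscale c p) \<subseteq> Poly_Mapping.keys p" by (auto simp: in_keys_iff)
  then show ?thesis
    by (simp add: fock_eval_superset[of "Poly_Mapping.keys p"] sum_distrib_left mult.assoc)
qed

lemma fock_eval_zero: "fock_eval 0 A = 0"
  by (simp add: fock_eval_def)

lemma fock_eval_diff: "fock_eval (p - q) A = fock_eval p A - fock_eval q A"
  using fock_eval_add[of "p - q" q A] by simp

lemma fock_op_vac: "n \<ge> 0 \<Longrightarrow> fock_op (Al n) fock_vac = (\<lambda>A. 0)"
  by (auto simp: fock_vac_def fun_eq_iff)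

lemma fock_eval_heis_rels: "p \<in> heis_rels \<Longrightarrow> fock_eval p A = 0"
  unfolding heis_rels_def
proof (elim UnE CollectE exE conjE)
  fix u x y w
  assume p: "p = word (u @ [x, y] @ w) - word (u @ [y, x] @ w)
    - tscale (bracket x y) (word (u @ [Cc] @ w))"
  let ?F = "foldr fock_op w fock_vac"
  have "fock_op Cc ?F = ?F" by (simp add: fun_eq_iff)
  then show "fock_eval p A = 0"
    unfolding p
    by (simp add: fock_eval_diff fock_eval_tscale fock_eval_word fock_word_linear
          fock_op_commute[of x y] del: bracket.simps fock_op.simps)
next
  fix u n assume "p = word (u @ [Al n])" "0 \<le> n"
  then show "fock_eval p A = 0"
    by (simp add: fock_eval_word fock_op_vac fock_word_zero del: fock_op.simps)
next
  fix u assume p: "p = word (u @ [Cc]) - word u"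
  have "fock_op Cc fock_vac = fock_vac" by (simp add: fun_eq_iff)
  then show "fock_eval p A = 0" by (simp add: p fock_eval_diff fock_eval_word)
qed

lemma fock_eval_span: "p \<in> tens.span heis_rels \<Longrightarrow> fock_eval p A = 0"
  by (induction rule: tens.span_induct_alt)
     (simp_all add: fock_eval_zero fock_eval_add fock_eval_tscale fock_eval_heis_rels)

lift_definition coord :: "heis \<Rightarrow> nat multiset \<Rightarrow> complex" is fock_eval
proof -
  fix p q assume "p - q \<in> tens.span heis_rels"
  then have "fock_eval (p - q) A = 0" for A by (rule fock_eval_span)
  then show "fock_eval p = fock_eval q" by (simp add: fock_eval_diff fun_eq_iff)
qed

lemma coord_add: "coord (v + w) A = coord v A + coord w A"
  by transfer (rule fock_eval_add)

lemma coord_hscale: "coord (hscale c v) A = c * coord v A"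
  by transfer (rule fock_eval_tscale)

lemma coord_zero [simp]: "coord 0 A = 0"
  by transfer (rule fock_eval_zero)

lemma coord_sum: "coord (\<Sum>i\<in>I. f i) A = (\<Sum>i\<in>I. coord (f i) A)"
  by (induction I rule: infinite_finite_induct) (auto simp: coord_add)

lemma coord_word: "coord (foldr heis_act w vac) = foldr fock_op w fock_vac"
  unfolding abs_heis_word[symmetric] coord.abs_eq by (rule fock_eval_word)

lemma coord_hmon:
  assumes "positive ns"
  shows "coord (hmon ns) A = (if A = mset ns then 1 else 0)"
proof -
  have "hmon ns = foldr heis_act (map (\<lambda>n. Al (- int n)) ns) vac"
    by (simp add: hmon_def foldr_map comp_def)
  then have *: "coord (hmon ns) = foldr fock_op (map (\<lambda>n. Al (- int n)) ns) fock_vac"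
    by (simp only: coord_word)
  show ?thesis using assms unfolding *
  proof (induction ns arbitrary: A)
    case Nil
    then show ?case by (simp add: fock_vac_def)
  next
    case (Cons n ns)
    then have "positive ns" "n \<ge> 1" by (auto simp: positive_def)
    with Cons.IH show ?case
      by (auto dest: insert_DiffM)
  qed
qed

definition mon_of :: "nat multiset \<Rightarrow> heis" where
  "mon_of A = hmon (sorted_list_of_multiset A)"

lemma mon_of_mset: "mon_of (mset ns) = hmon ns"
  unfolding mon_of_def by (rule hmon_mset) simp

lemma hmon_expansion:
  "\<exists>S. finite S \<and> (\<forall>A\<in>S. 0 \<notin># A) \<and> (\<forall>A. A \<notin> S \<longrightarrow> coord v A = 0) \<and>
       v = (\<Sum>A\<in>S. hscale (coord v A) (mon_of A))"
proof -
  have "v \<in> heis.span {hmon ns | ns. positive ns}" by (simp add: hmon_span)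
  then show ?thesis
  proof (induction rule: heis.span_induct_alt)
    case base
    show ?case by (rule exI[of _ "{}"]) simp
  next
    case (step c x y)
    from step(1) obtain ns where ns: "x = hmon ns" "positive ns" by auto
    from step(2) obtain S where S: "finite S" "\<forall>A\<in>S. 0 \<notin># A" "\<forall>A. A \<notin> S \<longrightarrow> coord y A = 0"
      "y = (\<Sum>A\<in>S. hscale (coord y A) (mon_of A))" by blast
    let ?T = "insert (mset ns) S"
    have fin: "finite ?T" using S by simp
    have "y = (\<Sum>A\<in>?T. hscale (coord y A) (mon_of A))"
      by (subst S(4), rule sum.mono_neutral_left) (use S in auto)
    moreover have "hscale c x = (\<Sum>A\<in>?T. hscale (coord (hscale c x) A) (mon_of A))"
    proof -
      have "(\<Sum>A\<in>?T. hscale (coord (hscale c x) A) (mon_of A)) =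
            (\<Sum>A\<in>?T. if A = mset ns then hscale c x else 0)"
        by (rule sum.cong) (auto simp: ns coord_hscale coord_hmon mon_of_mset)
      also have "\<dots> = hscale c x" using fin by simp
      finally show ?thesis ..
    qed
    ultimately have "hscale c x + y = (\<Sum>A\<in>?T. hscale (coord (hscale c x) A) (mon_of A))
        + (\<Sum>A\<in>?T. hscale (coord y A) (mon_of A))" by simp
    also have "\<dots> = (\<Sum>A\<in>?T. hscale (coord (hscale c x + y) A) (mon_of A))"
      by (simp add: coord_add heis.scale_left_distrib sum.distrib)
    finally have "hscale c x + y = (\<Sum>A\<in>?T. hscale (coord (hscale c x + y) A) (mon_of A))" .
    moreover have "\<forall>A\<in>?T. 0 \<notin># A" using S ns by (auto simp: positive_def)
    moreover have "\<forall>A. A \<notin> ?T \<longrightarrow> coord (hscale c x + y) A = 0"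
      using S ns by (auto simp: coord_add coord_hscale coord_hmon)
    ultimately show ?case using fin by blast
  qed
qed

lemma finite_coord: "finite {A. coord v A \<noteq> 0}"
proof -
  obtain S where "finite S" "\<forall>A. A \<notin> S \<longrightarrow> coord v A = 0"
    using hmon_expansion[of v] by blast
  then show ?thesis by (auto intro: finite_subset[of _ S])
qed

lemma coord_pos: "coord v A \<noteq> 0 \<Longrightarrow> 0 \<notin># A"
  using hmon_expansion[of v] by blast

lemma coord_expansion: "v = (\<Sum>A | coord v A \<noteq> 0. hscale (coord v A) (mon_of A))"
proof -
  obtain S where S: "finite S" "\<forall>A. A \<notin> S \<longrightarrow> coord v A = 0"
    "v = (\<Sum>A\<in>S. hscale (coord v A) (mon_of A))"
    using hmon_expansion[of v] by blast
  have "(\<Sum>A\<in>S. hscale (coord v A) (mon_of A)) = (\<Sum>A | coord v A \<noteq> 0. hscale (coord v A) (mon_of A))"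
    by (rule sum.mono_neutral_right) (use S in auto)
  with S(3) show ?thesis by metis
qed

lemma coord_eqI: "(\<And>A. coord v A = coord w A) \<Longrightarrow> v = w"
  using coord_expansion[of v] coord_expansion[of w] by simp

theorem hmon_eq_iff:
  assumes "positive ns" "positive ms"
  shows "hmon ns = hmon ms \<longleftrightarrow> mset ns = mset ms"
proof
  assume "hmon ns = hmon ms"
  then have "coord (hmon ns) (mset ns) = coord (hmon ms) (mset ns)" by simp
  then show "mset ns = mset ms" using assms by (simp add: coord_hmon split: if_splits)
qed (rule hmon_mset)

theorem hmon_independent: "heis.independent {hmon ns | ns. positive ns}"
  unfolding heis.dependent_explicit
proof (clarify)
  fix T u v
  assume T: "finite T" "T \<subseteq> {hmon ns | ns. positive ns}" "(\<Sum>v\<in>T. hscale (u v) v) = 0" "v \<in> T" "u v \<noteq> 0"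
  then obtain ns where ns: "v = hmon ns" "positive ns" by blast
  have "(\<Sum>v\<in>T. u v * coord v (mset ns)) = 0"
    using arg_cong[OF T(3), of "\<lambda>v. coord v (mset ns)"] by (simp add: coord_sum coord_hscale)
  also have "(\<Sum>v\<in>T. u v * coord v (mset ns)) = (\<Sum>x\<in>T. if x = v then u v else 0)"
  proof (rule sum.cong)
    fix x assume "x \<in> T"
    then obtain ms where "x = hmon ms" "positive ms" using T(2) by blast
    then show "u x * coord x (mset ns) = (if x = v then u v else 0)"
      using ns hmon_eq_iff[of ms ns] by (auto simp: coord_hmon)
  qed simp
  also have "\<dots> = u v" using T by simp
  finally show False using T by simp
qed

definition lin_ext :: "(nat multiset \<Rightarrow> heis) \<Rightarrow> heis \<Rightarrow> heis" where
  "lin_ext f v = (\<Sum>A | coord v A \<noteq> 0. hscale (coord v A) (f A))"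

lemma lin_ext_superset:
  assumes "finite S" "{A. coord v A \<noteq> 0} \<subseteq> S"
  shows "lin_ext f v = (\<Sum>A\<in>S. hscale (coord v A) (f A))"
  unfolding lin_ext_def by (rule sum.mono_neutral_left) (use assms in auto)

lemma linear_lin_ext: "Vector_Spaces.linear hscale hscale (lin_ext f)"
proof unfold_locales
  fix v w
  let ?S = "{A. coord v A \<noteq> 0} \<union> {A. coord w A \<noteq> 0}"
  have "lin_ext f (v + w) = (\<Sum>A\<in>?S. hscale (coord (v + w) A) (f A))"
    by (rule lin_ext_superset) (auto simp: finite_coord coord_add)
  also have "\<dots> = (\<Sum>A\<in>?S. hscale (coord v A) (f A)) + (\<Sum>A\<in>?S. hscale (coord w A) (f A))"
    by (simp add: coord_add heis.scale_left_distrib sum.distrib)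
  also have "\<dots> = lin_ext f v + lin_ext f w"
    by (subst (1 2) lin_ext_superset[of ?S]) (auto simp: finite_coord)
  finally show "lin_ext f (v + w) = lin_ext f v + lin_ext f w" .
next
  fix c v
  have "lin_ext f (hscale c v) = (\<Sum>A\<in>{A. coord v A \<noteq> 0}. hscale (coord (hscale c v) A) (f A))"
    by (rule lin_ext_superset) (auto simp: finite_coord coord_hscale)
  then show "lin_ext f (hscale c v) = hscale c (lin_ext f v)"
    by (simp add: lin_ext_def coord_hscale heis.scale_sum_right)
qed

lemma lin_ext_hmon:
  assumes "positive ns"
  shows "lin_ext f (hmon ns) = f (mset ns)"
proof -
  have "lin_ext f (hmon ns) = (\<Sum>A\<in>{mset ns}. hscale (coord (hmon ns) A) (f A))"
    by (rule lin_ext_superset) (auto simp: coord_hmon assms)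
  then show ?thesis by (simp add: coord_hmon assms)
qed

lemma linear_eq_lin_ext:
  assumes lin: "Vector_Spaces.linear hscale hscale h"
    and h: "\<And>A. 0 \<notin># A \<Longrightarrow> h (mon_of A) = f A"
  shows "h v = lin_ext f v"
proof -
  interpret h: Vector_Spaces.linear hscale hscale h by (rule lin)
  have "h v = h (\<Sum>A | coord v A \<noteq> 0. hscale (coord v A) (mon_of A))"
    using coord_expansion[of v] by simp
  also have "\<dots> = (\<Sum>A | coord v A \<noteq> 0. hscale (coord v A) (f A))"
    by (auto simp: h.sum h.scale h coord_pos intro!: sum.cong)
  finally show ?thesis by (simp add: lin_ext_def)
qed


section \<open>The vertex operators are well defined\<close>

theorem ex1_heis_mode: "\<exists>!Y. is_heis_mode Y"
proof -
  define f where "f p w A = nop_mode (rev (sorted_list_of_multiset A)) p w" for p w A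
  define Y where "Y v p w = lin_ext (f p w) v" for v p w
  show ?thesis
  proof (rule ex1I[of _ Y])
    show "is_heis_mode Y"
      unfolding is_heis_mode_def
    proof (intro conjI allI impI)
      show "Vector_Spaces.linear hscale hscale (\<lambda>v. Y v p w)" for p w
        unfolding Y_def by (rule linear_lin_ext)
      fix ns assume ns: "positive ns \<and> sorted_wrt (\<ge>) ns"
      have "rev (sorted_list_of_multiset (mset ns)) = ns"
      proof -
        have "sorted (rev ns)" using ns by (simp add: sorted_wrt_rev)
        then have "sort (rev ns) = rev ns" by (rule sorted_sort_id)
        moreover have "sort (rev ns) = sort ns" by (rule properties_for_sort) simp_all
        ultimately show ?thesis by simp
      qed
      then show "Y (hmon ns) = nop_mode ns"
        using ns by (simp add: Y_def fun_eq_iff lin_ext_hmon f_def)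
    qed
  next
    fix Y' assume Y': "is_heis_mode Y'"
    have "Y' v p w = Y v p w" for v p w
      unfolding Y_def
    proof (rule linear_eq_lin_ext)
      show "Vector_Spaces.linear hscale hscale (\<lambda>v. Y' v p w)"
        using Y' by (simp add: is_heis_mode_def)
      fix A :: "nat multiset" assume A: "0 \<notin># A"
      let ?ns = "rev (sorted_list_of_multiset A)"
      have pos: "positive ?ns"
        using A by (auto simp: positive_def Suc_le_eq intro!: gr0I)
      have "sorted_wrt (\<ge>) ?ns" by (simp add: sorted_wrt_rev)
      moreover have "mon_of A = hmon ?ns" using mon_of_mset[of ?ns] by simp
      ultimately show "Y' (mon_of A) p w = f p w A"
        using Y' pos by (simp add: is_heis_mode_def f_def)
    qed
    then show "Y' = Y" by (simp add: fun_eq_iff)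
  qed
qed

lemma is_heis_mode: "is_heis_mode heis_mode"
  unfolding heis_mode_def by (rule theI'[OF ex1_heis_mode])

lemma alpha_locally_nilpotent: "\<exists>N. \<forall>m\<ge>N. alpha m v = 0"
proof -
  have "v \<in> heis.span {hmon ns | ns. positive ns}" by (simp add: hmon_span)
  then show ?thesis
  proof (induction rule: heis.span_induct_alt)
    case base
    then show ?case by simp
  next
    case (step c x y)
    then obtain ns N where ns: "x = hmon ns" and N: "\<forall>m\<ge>N. alpha m y = 0" by auto
    have x: "alpha m (hmon ns) = 0" if "m \<ge> int (sum_list ns) + 1" for m
      using that
    proof (induction ns)
      case Nil
      then show ?case by (simp add: hmon_def alpha_vac)
    next
      case (Cons a ns)
      then show ?case unfolding alpha_hmon by (subst alpha_commute) auto
    qed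
    show ?case
      by (rule exI[of _ "max N (int (sum_list ns) + 1)"])
         (use N x in \<open>auto simp: alpha_add alpha_hscale ns\<close>)
  qed
qed

lemma foldr_alpha_zero: "foldr alpha ms 0 = 0"
  by (induction ms) auto

lemma foldr_alpha_annihilate:
  assumes "m \<in> set ms" "\<forall>m\<in>set ms. m \<ge> 0" "alpha m w = 0"
  shows "foldr alpha ms w = 0"
proof -
  obtain us vs where ms: "ms = us @ m # vs" using assms(1) by (meson split_list)
  have "alpha m (foldr alpha vs w) = foldr alpha vs (alpha m w)"
    if "\<forall>m\<in>set vs. m \<ge> 0" for vs
    using that assms(1,2) by (induction vs) (auto simp: alpha_commute_same_sign)
  then show ?thesis using assms by (simp add: ms foldr_alpha_zero)
qed

theorem finite_nop_support:
  assumes "positive ns"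
  shows "finite (nop_support ns p w)"
proof -
  obtain N0 where N0: "\<forall>m\<ge>N0. alpha m w = 0" using alpha_locally_nilpotent by blast
  define N where "N = max N0 0"
  define B where "B = N + int (sum_list ns)"
  define L where "L = - (\<bar>p\<bar> + 1 + int (sum_list ns) + int (length ns) * B)"
  have "nop_support ns p w \<subseteq> {ms. set ms \<subseteq> {L..N} \<and> length ms = length ns}"
  proof (rule subsetI, rule CollectI, rule conjI[rotated])
    fix ms assume ms: "ms \<in> nop_support ns p w"
    then have len: "length ms = length ns"
      and sum: "sum_list ms + int (sum_list ns) = p + 1"
      and nz: "nop_term ns ms w \<noteq> 0" by (auto simp: nop_support_def)
    show "length ms = length ns" by (rule len)
    have upper: "m < N" if m: "m \<in> set ms" "m \<ge> 0" for m
    proof (rule ccontr)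
      assume "\<not> m < N"
      then have "alpha m w = 0" using N0 by (simp add: N_def)
      then have "foldr alpha (filter (\<lambda>m. m \<ge> 0) ms) w = 0"
        using m by (intro foldr_alpha_annihilate[of m]) auto
      then have "nop_term ns ms w = 0"
        by (simp add: nop_term_def normal_order_def foldr_alpha_zero)
      with nz show False by simp
    qed
    have "N \<ge> 0" by (simp add: N_def)
    have bound: "m \<le> N" if "m \<in> set ms" for m
      using upper[of m] that \<open>N \<ge> 0\<close> by (cases "m \<ge> 0") auto
    show "set ms \<subseteq> {L..N}"
    proof
      fix m assume m: "m \<in> set ms"
      then obtain us vs where split: "ms = us @ m # vs" by (meson split_list)
      have le: "sum_list xs \<le> int (length xs) * N" if "\<forall>x\<in>set xs. x \<le> N" for xs
        using that by (induction xs) (auto simp: algebra_simps)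
      have "sum_list us \<le> int (length us) * N" "sum_list vs \<le> int (length vs) * N"
        using bound by (auto intro!: le simp: split)
      moreover have "length us + length vs \<le> length ns" using len by (simp add: split)
      then have "int (length us + length vs) * N \<le> int (length ns) * N"
        using \<open>N \<ge> 0\<close> by (intro mult_right_mono) auto
      moreover have "int (length ns) * N \<le> int (length ns) * B"
        by (intro mult_left_mono) (auto simp: B_def)
      ultimately have "m \<ge> L"
        using sum by (simp add: split L_def algebra_simps)
      then show "m \<in> {L..N}" using bound m by simp
    qed
  qed
  then show ?thesis by (rule finite_subset) (simp add: finite_lists_length_eq)
qed


section \<open>The eigenspace decomposition\<close>

lemma positive_sorted_list: "0 \<notin># A \<Longrightarrow> positive (sorted_list_of_multiset A)"
  by (auto simp: positive_def Suc_le_eq intro!: gr0I)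

lemma coord_length_space:
  assumes "v \<in> length_space d" "coord v A \<noteq> 0"
  shows "int (size A) = d"
proof -
  have "int (size A) \<noteq> d \<longrightarrow> coord v A = 0"
    using assms(1) unfolding length_space_def
    by (induction rule: heis.span_induct_alt)
       (auto simp: coord_add coord_hscale coord_hmon split: if_splits)
  with assms(2) show ?thesis by blast
qed

lemma mon_of_length_space: "0 \<notin># A \<Longrightarrow> mon_of A \<in> length_space (int (size A))"
  unfolding length_space_def mon_of_def
  using positive_sorted_list[of A]
  by (auto intro!: heis.span_base exI[of _ "sorted_list_of_multiset A"]
        simp flip: size_mset)

lemma residue_space_coord:
  "v \<in> residue_space k l \<longleftrightarrow> (\<forall>A. coord v A \<noteq> 0 \<longrightarrow> int (size A) mod k = l mod k)"
proof
  assume "v \<in> residue_space k l"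
  then have "\<forall>A. int (size A) mod k \<noteq> l mod k \<longrightarrow> coord v A = 0"
    unfolding residue_space_def
  proof (induction rule: heis.span_induct_alt)
    case base
    then show ?case by simp
  next
    case (step c x y)
    from step(1) obtain m where x: "x \<in> length_space (l + k * m)" by blast
    show ?case
    proof (intro allI impI)
      fix A :: "nat multiset" assume A: "int (size A) mod k \<noteq> l mod k"
      have "coord x A = 0"
      proof (rule ccontr)
        assume "coord x A \<noteq> 0"
        with x have "int (size A) = l + k * m" by (rule coord_length_space)
        with A show False by simp
      qed
      with step A show "coord (hscale c x + y) A = 0" by (simp add: coord_add coord_hscale)
    qed
  qed
  then show "\<forall>A. coord v A \<noteq> 0 \<longrightarrow> int (size A) mod k = l mod k" by blast
next
  assume *: "\<forall>A. coord v A \<noteq> 0 \<longrightarrow> int (size A) mod k = l mod k"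
  have "(\<Sum>A | coord v A \<noteq> 0. hscale (coord v A) (mon_of A)) \<in> residue_space k l"
    unfolding residue_space_def
  proof (intro heis.span_sum heis.span_scale heis.span_base)
    fix A assume A: "A \<in> {A. coord v A \<noteq> 0}"
    then have "k dvd int (size A) - l" using * by (simp add: mod_eq_dvd_iff)
    then obtain m where "int (size A) = l + k * m"
      by (metis diff_eq_eq dvdE add.commute)
    with A mon_of_length_space[of A] coord_pos[of v A]
    show "mon_of A \<in> (\<Union>m. length_space (l + k * m))" by auto
  qed
  then show "v \<in> residue_space k l" using coord_expansion[of v] by simp
qed

lemma root_of_unity_eq_iff:
  fixes k a b :: int
  assumes "k > 0"
  shows "exp (2 * of_real pi * \<i> * of_int a / of_int k) = exp (2 * of_real pi * \<i> * of_int b / of_int k)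
    \<longleftrightarrow> a mod k = b mod k"
proof -
  have "exp (2 * of_real pi * \<i> * of_int a / of_int k) = exp (2 * of_real pi * \<i> * of_int b / of_int k)
    \<longleftrightarrow> (\<exists>n::int. 2 * of_real pi * \<i> * of_int a / of_int k
          = 2 * of_real pi * \<i> * of_int b / of_int k + (of_int (2 * n) * pi) * \<i>)"
    by (rule exp_eq)
  also have "\<dots> \<longleftrightarrow> (\<exists>n::int. (of_int a :: complex) = of_int (b + k * n))"
  proof (intro ex_cong1)
    fix n :: int
    let ?c = "2 * of_real pi * \<i> / of_int k :: complex"
    have "2 * of_real pi * \<i> * of_int b / of_int k + (of_int (2 * n) * pi) * \<i>
        = ?c * of_int (b + k * n)"
      using assms by (simp add: field_simps)
    moreover have "2 * of_real pi * \<i> * of_int a / of_int k = ?c * of_int a" by simp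
    moreover have "?c \<noteq> 0" using assms by simp
    ultimately show "2 * of_real pi * \<i> * of_int a / of_int k
          = 2 * of_real pi * \<i> * of_int b / of_int k + (of_int (2 * n) * pi) * \<i>
        \<longleftrightarrow> (of_int a :: complex) = of_int (b + k * n)"
      by (simp only: mult_cancel_left) simp
  qed
  also have "\<dots> \<longleftrightarrow> (\<exists>n. a = b + k * n)" by (simp only: of_int_eq_iff)
  also have "\<dots> \<longleftrightarrow> a mod k = b mod k"
    by (metis mod_eq_dvd_iff dvd_def diff_eq_eq add.commute)
  finally show ?thesis .
qed

lemma coord_length_rotation:
  assumes g: "is_length_rotation k g"
  shows "coord (g v) A = exp (2 * of_real pi * \<i> * of_nat (size A) / of_int k) * coord v A"
proof -
  let ?z = "\<lambda>A. exp (2 * of_real pi * \<i> * of_nat (size A) / of_int k)"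
  have "g v = lin_ext (\<lambda>A. hscale (?z A) (mon_of A)) v"
  proof (rule linear_eq_lin_ext)
    show "Vector_Spaces.linear hscale hscale g" using g by (simp add: is_length_rotation_def)
    fix A :: "nat multiset" assume "0 \<notin># A"
    then show "g (mon_of A) = hscale (?z A) (mon_of A)"
      using g positive_sorted_list[of A]
      by (auto simp: is_length_rotation_def mon_of_def simp flip: size_mset)
  qed
  then have "coord (g v) A = (\<Sum>B | coord v B \<noteq> 0. coord v B * ?z B * coord (mon_of B) A)"
    by (simp add: lin_ext_def coord_sum coord_hscale)
  also have "\<dots> = (\<Sum>B | coord v B \<noteq> 0. if B = A then coord v A * ?z A else 0)"
  proof (rule sum.cong)
    fix B assume "B \<in> {B. coord v B \<noteq> 0}"
    then have "0 \<notin># B" using coord_pos by blast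
    then have "coord (mon_of B) A = (if A = B then 1 else 0)"
      using positive_sorted_list[of B] by (simp add: mon_of_def coord_hmon)
    then show "coord v B * ?z B * coord (mon_of B) A = (if B = A then coord v A * ?z A else 0)"
      by simp
  qed simp
  also have "\<dots> = ?z A * coord v A" using finite_coord[of v] by simp
  finally show ?thesis .
qed

theorem ex1_length_rotation: "\<exists>!g. is_length_rotation k g"
proof (rule ex1I)
  let ?g = "lin_ext (\<lambda>A. hscale (exp (2 * of_real pi * \<i> * of_nat (size A) / of_int k)) (mon_of A))"
  show g: "is_length_rotation k ?g"
    by (simp add: is_length_rotation_def linear_lin_ext lin_ext_hmon mon_of_mset)
  fix h assume "is_length_rotation k h"
  then show "h = ?g" using g by (auto simp: coord_length_rotation intro!: coord_eqI ext)
qed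

theorem length_rotation_order:
  assumes "k > 0" "is_length_rotation k g"
  shows "(g ^^ j) = id \<longleftrightarrow> k dvd int j"
proof -
  have coord_pow: "coord ((g ^^ j) v) A
      = exp (2 * of_real pi * \<i> * of_int (int j * int (size A)) / of_int k) * coord v A" for v A
  proof (induction j)
    case (Suc j)
    then show ?case
      by (simp add: coord_length_rotation[OF assms(2)] algebra_simps add_divide_distrib flip: exp_add)
  qed simp
  have one: "exp (2 * of_real pi * \<i> * of_int a / of_int k) = 1 \<longleftrightarrow> k dvd a" for a
    using root_of_unity_eq_iff[OF assms(1), of a 0] by (simp add: mod_eq_0_iff_dvd)
  show ?thesis
  proof
    assume id: "g ^^ j = id"
    have pos: "positive [1]" by (simp add: positive_def)
    have "coord ((g ^^ j) (hmon [1])) {#1#} = coord (hmon [1]) {#1#}" using id by simp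
    then have "exp (2 * of_real pi * \<i> * of_int (int j) / of_int k) = 1"
      unfolding coord_pow using pos by (simp add: coord_hmon)
    then show "k dvd int j" by (simp only: one)
  next
    assume "k dvd int j"
    then have "exp (2 * of_real pi * \<i> * of_int (int j * int s) / of_int k) = 1" for s
      unfolding one by simp
    then have "(g ^^ j) v = v" for v by (intro coord_eqI) (simp only: coord_pow mult_1)
    then show "g ^^ j = id" by (simp add: fun_eq_iff)
  qed
qed

theorem residue_space_eigenspace:
  assumes "k > 0" "is_length_rotation k g"
  shows "residue_space k l = {v. g v = hscale (exp (2 * of_real pi * \<i> * of_int l / of_int k)) v}"
proof -
  have "g v = hscale (exp (2 * of_real pi * \<i> * of_int l / of_int k)) v \<longleftrightarrow> v \<in> residue_space k l" for v
  proof -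
    have "g v = hscale (exp (2 * of_real pi * \<i> * of_int l / of_int k)) v \<longleftrightarrow>
        (\<forall>A. coord v A \<noteq> 0 \<longrightarrow> exp (2 * of_real pi * \<i> * of_int (int (size A)) / of_int k)
               = exp (2 * of_real pi * \<i> * of_int l / of_int k))"
      (is "?L \<longleftrightarrow> ?R")
    proof
      assume L: ?L
      show ?R
      proof (intro allI impI)
        fix A assume "coord v A \<noteq> 0"
        with arg_cong[OF L, of "\<lambda>v. coord v A"]
        show "exp (2 * of_real pi * \<i> * of_int (int (size A)) / of_int k)
               = exp (2 * of_real pi * \<i> * of_int l / of_int k)"
          by (simp add: coord_length_rotation[OF assms(2)] coord_hscale)
      qed
    next
      assume R: ?R
      show ?L
      proof (rule coord_eqI)
        fix A
        show "coord (g v) A = coord (hscale (exp (2 * of_real pi * \<i> * of_int l / of_int k)) v) A"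
          using R by (cases "coord v A = 0") (simp_all add: coord_length_rotation[OF assms(2)] coord_hscale)
      qed
    qed
    then show ?thesis by (simp only: root_of_unity_eq_iff[OF assms(1)] residue_space_coord)
  qed
  then show ?thesis by blast
qed

theorem residue_space_sum:
  assumes "k > 0"
  shows "heis.span (\<Union>l\<in>{0..k-1}. residue_space k l) = UNIV"
proof -
  have "v \<in> heis.span (\<Union>l\<in>{0..k-1}. residue_space k l)" for v
  proof -
    have "(\<Sum>A | coord v A \<noteq> 0. hscale (coord v A) (mon_of A))
        \<in> heis.span (\<Union>l\<in>{0..k-1}. residue_space k l)"
    proof (intro heis.span_sum heis.span_scale heis.span_base)
      fix A assume "A \<in> {A. coord v A \<noteq> 0}"
      then have "0 \<notin># A" using coord_pos by blast
      then have "mon_of A \<in> residue_space k (int (size A) mod k)"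
        using positive_sorted_list[of A]
        by (auto simp: residue_space_coord mon_of_def coord_hmon)
      then show "mon_of A \<in> (\<Union>l\<in>{0..k-1}. residue_space k l)"
        using assms by (intro UN_I[of "int (size A) mod k"]) auto
    qed
    then show ?thesis using coord_expansion[of v] by simp
  qed
  then show ?thesis by blast
qed

theorem residue_space_direct:
  assumes "\<And>l. l \<in> {0..k-1} \<Longrightarrow> f l \<in> residue_space k l"
    and "(\<Sum>l\<in>{0..k-1}. f l) = 0" and "l \<in> {0..k-1}"
  shows "f l = 0"
proof (rule coord_eqI)
  fix A
  show "coord (f l) A = coord 0 A"
  proof (cases "int (size A) mod k = l")
    case True
    have "0 = (\<Sum>j\<in>{0..k-1}. coord (f j) A)"
      using arg_cong[OF assms(2), of "\<lambda>v. coord v A"] by (simp add: coord_sum)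
    also have "\<dots> = (\<Sum>j\<in>{l}. coord (f j) A)"
    proof (rule sum.mono_neutral_right)
      show "\<forall>j\<in>{0..k-1} - {l}. coord (f j) A = 0"
      proof
        fix j assume j: "j \<in> {0..k-1} - {l}"
        then have "f j \<in> residue_space k j" "j mod k = j" using assms(1) by auto
        then show "coord (f j) A = 0" using j True unfolding residue_space_coord by auto
      qed
    qed (use assms(3) in auto)
    finally show ?thesis by simp
  next
    case False
    moreover have "l mod k = l" using assms(3) by simp
    ultimately show ?thesis using assms(1)[OF assms(3)] unfolding residue_space_coord by auto
  qed
qed


end

theory Submission
  imports Defs "HOL-Library.Multiset_Order"
begin

text \<open>Both radicals vanish. Order the monomials by length and then by the multiset order. In
  \<open>v(-1) w\<close> the part of top length is the product of the top parts of \<open>v\<close> and \<open>w\<close> in the polynomial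
  algebra, since every annihilation operator lowers the length. Hence leading monomials multiply,
  and if \<open>v \<noteq> 0\<close> has a leading monomial of length \<open>d\<close>, then \<open>v(-1)\<^sup>t \<one>\<close> has one of length \<open>t d\<close>. For
  \<open>k\<close> dividing \<open>t\<close> this is a component in \<open>M\<^sub>1\<^sup>(\<^sup>0\<^sup>)(1)\<close>, which is absent from \<open>M\<close>.\<close>

section \<open>Heisenberg modes and the filtration by length\<close>

lemma coord_alpha: "coord (alpha n v) = fock_op (Al n) (coord v)"
  using heis_words_span[of v]
proof (induction rule: heis.span_induct_alt)
  case base
  then show ?case by (simp add: fun_eq_iff)
next
  case (step c x y)
  then obtain w where x: "x = foldr heis_act w vac" by auto
  have "coord (alpha n x) = fock_op (Al n) (coord x)"
    using coord_word[of "Al n # w"] coord_word[of w] by (simp add: x del: fock_op.simps)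
  with step.IH show ?case
    by (auto simp: fun_eq_iff alpha_add alpha_hscale coord_add coord_hscale algebra_simps)
qed

text \<open>An integer index lets the bound drop below length 0, where only the zero vector
  remains.\<close>

definition length_le :: "int \<Rightarrow> heis set" where
  "length_le d = {v. \<forall>A. coord v A \<noteq> 0 \<longrightarrow> int (size A) \<le> d}"

lemma length_le_mono: "v \<in> length_le d \<Longrightarrow> d \<le> e \<Longrightarrow> v \<in> length_le e"
  by (force simp: length_le_def)

lemma subspace_length_le: "heis.subspace (length_le d)"
  unfolding heis.subspace_def by (force simp: length_le_def coord_add coord_hscale)

lemma alpha_length_le:
  assumes "v \<in> length_le d"
  shows "alpha m v \<in> length_le (if m < 0 then d + 1 else d - 1)"
  unfolding length_le_def
proof (intro CollectI allI impI)
  fix A assume A: "coord (alpha m v) A \<noteq> 0"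
  have *: "int (size B) \<le> d" if "coord v B \<noteq> 0" for B
    using assms that by (auto simp: length_le_def)
  show "int (size A) \<le> (if m < 0 then d + 1 else d - 1)"
  proof (cases "m < 0")
    case True
    with A have "nat (- m) \<in># A" "coord v (A - {#nat (- m)#}) \<noteq> 0"
      by (auto simp: coord_alpha split: if_splits)
    with *[of "A - {#nat (- m)#}"] True show ?thesis
      by (auto dest!: multi_member_split)
  next
    case False
    with A have "coord v (add_mset (nat m) A) \<noteq> 0" by (auto simp: coord_alpha)
    from *[OF this] False show ?thesis by simp
  qed
qed

lemma foldr_alpha_length_le:
  assumes "v \<in> length_le d"
  shows "foldr alpha ms v \<in>
    length_le (d + int (length (filter (\<lambda>m. m < 0) ms)) - int (length (filter (\<lambda>m. m \<ge> 0) ms)))"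
proof (induction ms)
  case (Cons m ms)
  from alpha_length_le[OF Cons.IH, of m] show ?case
    by (auto elim!: length_le_mono)
qed (use assms in simp)

text \<open>With \<open>a\<close> nonnegative entries in \<open>ms\<close>, the length rises by at
  most \<open>length ns - 2 * a\<close>, so a single annihilation operator keeps the term strictly
  below the top length \<open>d + length ns\<close>.\<close>

lemma nop_term_length_le:
  assumes "w \<in> length_le d" and "length ms = length ns" and "\<exists>m\<in>set ms. m \<ge> 0"
  shows "nop_term ns ms w \<in> length_le (d + int (length ns) - 1)"
proof -
  have sum: "length (filter (\<lambda>m. m < 0) ms) + length (filter (\<lambda>m. m \<ge> 0) ms) = length ns"
    using sum_length_filter_compl[of "\<lambda>m. m < 0" ms] assms(2) by (simp add: not_less)
  have "filter (\<lambda>m. m \<ge> 0) ms \<noteq> []" using assms(3) by (simp add: filter_empty_conv not_less)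
  then have pos: "length (filter (\<lambda>m. m \<ge> 0) ms) \<ge> 1" by (simp add: Suc_le_eq)
  have "foldr alpha (normal_order ms) w \<in> length_le (d + int (length ns) - 1)"
    by (rule length_le_mono[OF foldr_alpha_length_le[OF assms(1)]])
       (use sum pos in \<open>simp add: normal_order_def filter_filter conj_commute cong: conj_cong\<close>)
  then show ?thesis
    unfolding nop_term_def by (rule heis.subspace_scale[OF subspace_length_le])
qed

section \<open>The part of top length in the mode -1\<close>

lemma field_coeff_eq_0: "m < 0 \<Longrightarrow> - m < int n \<Longrightarrow> field_coeff n m = 0"
proof -
  assume "m < 0" "- m < int n"
  \<comment> \<open>The operator \<open>alpha m\<close> comes with z^(-m-1), here a monomial of
    natural degree below \<open>n - 1\<close>, so the derivative of order \<open>n - 1\<close> kills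
    it.\<close>
  then have "of_int (- m - 1) = (of_nat (nat (- m - 1)) :: complex)" "nat (- m - 1) < n - 1"
    by (auto simp: of_nat_nat)
  then show "field_coeff n m = 0"
    by (simp only: field_coeff_def flip: binomial_gbinomial) (simp add: binomial_eq_0)
qed

lemma field_coeff_minus: "n \<ge> 1 \<Longrightarrow> field_coeff n (- int n) = 1"
proof -
  assume "n \<ge> 1"
  then have "of_int (- (- int n) - 1) = (of_nat (n - 1) :: complex)" by (simp add: of_nat_diff)
  then show ?thesis
    by (simp only: field_coeff_def flip: binomial_gbinomial) simp
qed

text \<open>By \<open>field_coeff_eq_0\<close>, nonzero factors force each entry of
  \<open>ms\<close> to be at most minus the matching entry of \<open>ns\<close>; a vanishing total
  then leaves equality everywhere. In the mode -1 the total does vanish, by the definition of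
  \<open>nop_support\<close>.\<close>

lemma field_coeff_prod_negative:
  assumes "length ms = length ns" and "\<forall>m\<in>set ms. m < 0"
    and "(\<Prod>(n, m) \<leftarrow> zip ns ms. field_coeff n m) \<noteq> 0"
  shows "sum_list ms + int (sum_list ns) \<le> 0 \<and>
    (sum_list ms + int (sum_list ns) = 0 \<longrightarrow> ms = map (\<lambda>n. - int n) ns)"
  using assms
proof (induction ms ns rule: list_induct2)
  case (Cons m ms n ns)
  then have "m + int n \<le> 0" using field_coeff_eq_0[of m n] by force
  with Cons show ?case by auto
qed simp

lemma nop_term_creation:
  assumes "positive ns"
  shows "nop_term ns (map (\<lambda>n. - int n) ns) w = foldr (\<lambda>n. alpha (- int n)) ns w"
proof -
  have "(\<Prod>(n, m) \<leftarrow> zip ns (map (\<lambda>n. - int n) ns). field_coeff n m) = 1"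
    using assms by (induction ns) (auto simp: positive_def field_coeff_minus)
  moreover have "normal_order (map (\<lambda>n. - int n) ns) = map (\<lambda>n. - int n) ns"
  proof -
    have neg: "\<forall>m\<in>set (map (\<lambda>n. - int n) ns). m < 0"
      using assms by (auto simp: positive_def Suc_le_eq)
    then have "filter (\<lambda>m. m < 0) (map (\<lambda>n. - int n) ns) = map (\<lambda>n. - int n) ns"
      by (intro filter_True)
    moreover have "filter (\<lambda>m. m \<ge> 0) (map (\<lambda>n. - int n) ns) = []"
      using neg by (intro filter_False) (simp add: not_le)
    ultimately show ?thesis by (simp only: normal_order_def append_Nil2)
  qed
  ultimately show ?thesis by (simp add: nop_term_def foldr_map comp_def)
qed

text \<open>The subtracted product is the only term made of creation operators alone; every other
  nonzero term contains an annihilation operator and so has smaller length.\<close>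

lemma nop_mode_leading:
  assumes "positive ns" and "w \<in> length_le d"
  shows "nop_mode ns (- 1) w - foldr (\<lambda>n. alpha (- int n)) ns w \<in> length_le (d + int (length ns) - 1)"
proof -
  let ?S = "nop_support ns (- 1) w" and ?c = "map (\<lambda>n. - int n) ns"
  have fin: "finite ?S" by (rule finite_nop_support[OF assms(1)])
  have "sum_list ?c + int (sum_list ns) = 0" by (induction ns) auto
  \<comment> \<open>\<open>nop_support\<close> keeps only nonzero terms, so it may miss
    \<open>?c\<close>; in that case inserting \<open>?c\<close> adds zero.\<close>
  then have "nop_mode ns (- 1) w = (\<Sum>ms \<in> insert ?c ?S. nop_term ns ms w)"
    unfolding nop_mode_def
    by (intro sum.mono_neutral_left) (use fin in \<open>auto simp: nop_support_def\<close>)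
  also have "\<dots> = nop_term ns ?c w + (\<Sum>ms \<in> ?S - {?c}. nop_term ns ms w)"
    by (rule sum.insert_remove[OF fin])
  finally have "nop_mode ns (- 1) w - foldr (\<lambda>n. alpha (- int n)) ns w
      = (\<Sum>ms \<in> ?S - {?c}. nop_term ns ms w)"
    by (simp add: nop_term_creation[OF assms(1)])
  also have "\<dots> \<in> length_le (d + int (length ns) - 1)"
  proof (rule heis.subspace_sum[OF subspace_length_le])
    fix ms assume "ms \<in> ?S - {?c}"
    then have ms: "length ms = length ns" "sum_list ms + int (sum_list ns) = 0"
        "nop_term ns ms w \<noteq> 0" "ms \<noteq> ?c"
      by (auto simp: nop_support_def)
    then have "(\<Prod>(n, m) \<leftarrow> zip ns ms. field_coeff n m) \<noteq> 0"
      by (auto simp: nop_term_def)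
    then have "\<exists>m\<in>set ms. m \<ge> 0"
      using field_coeff_prod_negative[of ms ns] ms by force
    then show "nop_term ns ms w \<in> length_le (d + int (length ns) - 1)"
      by (rule nop_term_length_le[OF assms(2) ms(1)])
  qed
  finally show ?thesis .
qed

text \<open>In the polynomial algebra this is multiplication by the monomial
  \<open>mset ns\<close>.\<close>

lemma coord_foldr_creation:
  assumes "positive ns"
  shows "coord (foldr (\<lambda>n. alpha (- int n)) ns w) X =
    (if mset ns \<subseteq># X then coord w (X - mset ns) else 0)"
  using assms
proof (induction ns arbitrary: X)
  case (Cons n ns)
  then have "positive ns" "n \<ge> 1" by (auto simp: positive_def)
  with Cons.IH show ?case
    by (auto simp: coord_alpha insert_subset_eq_iff)
qed simp

text \<open>\<open>is_heis_mode\<close> prescribes the modes on weakly decreasing lists, while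
  \<open>mon_of\<close> uses the increasing one. Reversing the list keeps the monomial, as creation
  operators commute.\<close>

lemma heis_mode_mon_of:
  assumes "0 \<notin># A"
  obtains ns where "positive ns" "mset ns = A" "heis_mode (mon_of A) = nop_mode ns"
proof
  let ?ns = "rev (sorted_list_of_multiset A)"
  show "positive ?ns" using positive_sorted_list[OF assms] by (simp add: positive_def)
  moreover have "sorted_wrt (\<ge>) ?ns" by (simp add: sorted_wrt_rev)
  moreover have "mon_of A = hmon ?ns" using mon_of_mset[of ?ns] by simp
  ultimately show "heis_mode (mon_of A) = nop_mode ?ns"
    using is_heis_mode by (simp add: is_heis_mode_def)
qed simp

lemma heis_mode_expansion:
  "heis_mode v p w = (\<Sum>A | coord v A \<noteq> 0. hscale (coord v A) (heis_mode (mon_of A) p w))"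
proof -
  have "Vector_Spaces.linear hscale hscale (\<lambda>v. heis_mode v p w)"
    using is_heis_mode by (simp add: is_heis_mode_def)
  from linear_eq_lin_ext[OF this refl, of v] show ?thesis by (simp add: lin_ext_def)
qed

text \<open>The remainder from \<open>nop_mode_leading\<close> lives in lengths below
  \<open>d + size P\<close>, hence is invisible at \<open>X\<close>.\<close>

lemma coord_heis_mode_mon_of:
  assumes "0 \<notin># P" and "w \<in> length_le d" and "int (size X) \<ge> d + int (size P)"
  shows "coord (heis_mode (mon_of P) (- 1) w) X = (if P \<subseteq># X then coord w (X - P) else 0)"
proof -
  obtain ns where ns: "positive ns" "mset ns = P" "heis_mode (mon_of P) = nop_mode ns"
    using heis_mode_mon_of[OF assms(1)] .
  let ?c = "foldr (\<lambda>n. alpha (- int n)) ns w"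
  have "nop_mode ns (- 1) w - ?c \<in> length_le (d + int (size P) - 1)"
    using nop_mode_leading[OF ns(1) assms(2)] ns(2) by auto
  then have "coord (nop_mode ns (- 1) w - ?c) X = 0"
    using assms(3) by (force simp: length_le_def)
  then have "coord (nop_mode ns (- 1) w) X = coord ?c X"
    using coord_add[of "nop_mode ns (- 1) w - ?c" ?c X] by simp
  then show ?thesis using coord_foldr_creation[OF ns(1)] ns by simp
qed

section \<open>Leading monomials and their multiplicativity\<close>

definition leads :: "heis \<Rightarrow> nat multiset \<Rightarrow> bool" where
  "leads v A \<longleftrightarrow> coord v A \<noteq> 0 \<and>
     (\<forall>X. coord v X \<noteq> 0 \<longrightarrow> size X < size A \<or> size X = size A \<and> X \<le> A)"

lemma leads_length_le: "leads v A \<Longrightarrow> v \<in> length_le (int (size A))"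
  by (force simp: leads_def length_le_def)

lemma ex_leads:
  assumes "v \<noteq> 0"
  shows "\<exists>A. leads v A"
proof -
  let ?S = "{A. coord v A \<noteq> 0}"
  have fin: "finite ?S" by (rule finite_coord)
  have "?S \<noteq> {}" using assms coord_eqI[of v 0] by auto
  define d where "d = Max (size ` ?S)"
  let ?T = "{A \<in> ?S. size A = d}"
  have "d \<in> size ` ?S" unfolding d_def using fin \<open>?S \<noteq> {}\<close> by (intro Max_in) auto
  then have T: "finite ?T" "?T \<noteq> {}" using fin by auto
  have "size X \<le> d" if "coord v X \<noteq> 0" for X
    unfolding d_def using fin that by (intro Max_ge) auto
  moreover have "X \<le> Max ?T" if "coord v X \<noteq> 0" "size X = d" for X
    using T that by (intro Max_ge) auto
  moreover have "Max ?T \<in> ?T" by (rule Max_in[OF T])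
  ultimately have "leads v (Max ?T)" unfolding leads_def by (force simp: le_less)
  then show ?thesis ..
qed

text \<open>A contribution at \<open>X\<close> splits it as \<open>P + R\<close> with
  \<open>P\<close> not above \<open>A\<close> and \<open>R\<close> not above \<open>B\<close>.
  Length and multiset order are both compatible with sums, so only \<open>P = A\<close> and
  \<open>R = B\<close> can reach \<open>A + B\<close>, and nothing exceeds it.\<close>

lemma coord_heis_mode_leading:
  assumes v: "leads v A" and w: "leads w B"
    and X: "size X > size (A + B) \<or> size X = size (A + B) \<and> X \<ge> A + B"
  shows "coord (heis_mode v (- 1) w) X = (if X = A + B then coord v A * coord w B else 0)"
proof -
  have "coord v A \<noteq> 0" using v by (simp add: leads_def)
  have summand: "coord v P * coord (heis_mode (mon_of P) (- 1) w) X
      = (if P = A \<and> X = A + B then coord v A * coord w B else 0)"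
    if P: "coord v P \<noteq> 0" for P
  proof -
    have le: "size P < size A \<or> size P = size A \<and> P \<le> A" using v P by (auto simp: leads_def)
    have coord: "coord (heis_mode (mon_of P) (- 1) w) X = (if P \<subseteq># X then coord w (X - P) else 0)"
      by (rule coord_heis_mode_mon_of[OF coord_pos[OF P] leads_length_le[OF w]])
         (use X le in auto)
    have eq: "P = A \<and> X = A + B" if "P \<subseteq># X" "coord w (X - P) \<noteq> 0"
    proof -
      define R where "R = X - P"
      have XPR: "X = P + R" using that(1) by (simp add: R_def)
      have R: "size R < size B \<or> size R = size B \<and> R \<le> B"
        using w that(2) by (auto simp: leads_def R_def)
      \<comment> \<open>\<open>P\<close> and \<open>R\<close> are no longer than \<open>A\<close>
        and \<open>B\<close>, yet \<open>X\<close> is no shorter than \<open>A + B\<close>. Hence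
        the lengths agree and only the tie-break by the multiset order remains.\<close>
      then have sz: "size P = size A" "size R = size B" and "A + B \<le> P + R"
        using le X by (auto simp: XPR)
      then have "P \<le> A" "R \<le> B" using le R by auto
      have "P = A"
      proof (rule ccontr)
        assume "P \<noteq> A"
        with \<open>P \<le> A\<close> have "P < A" by (rule le_neq_trans)
        then have "P + R < A + B" using \<open>R \<le> B\<close> by (rule add_less_le_mono)
        from less_le_trans[OF this \<open>A + B \<le> P + R\<close>] show False by simp
      qed
      with \<open>A + B \<le> P + R\<close> have "B \<le> R" by simp
      with \<open>R \<le> B\<close> have "R = B" by (rule antisym)
      with \<open>P = A\<close> show ?thesis by (simp add: XPR)
    qed
    show ?thesis
    proof (cases "P = A \<and> X = A + B")
      case True
      then show ?thesis unfolding coord by simp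
    next
      case False
      with eq have "(if P \<subseteq># X then coord w (X - P) else 0) = 0" by argo
      with False show ?thesis by (simp only: coord if_False mult_zero_right)
    qed
  qed
  have "coord (heis_mode v (- 1) w) X
      = (\<Sum>P | coord v P \<noteq> 0. coord v P * coord (heis_mode (mon_of P) (- 1) w) X)"
    by (subst heis_mode_expansion) (simp add: coord_sum coord_hscale)
  also have "\<dots> = (\<Sum>P | coord v P \<noteq> 0. if P = A then (if X = A + B then coord v A * coord w B else 0) else 0)"
    by (rule sum.cong) (simp_all add: summand)
  also have "\<dots> = (if X = A + B then coord v A * coord w B else 0)"
    using finite_coord[of v] \<open>coord v A \<noteq> 0\<close> by simp
  finally show ?thesis .
qed

lemma leads_heis_mode:
  assumes "leads v A" and "leads w B"
  shows "leads (heis_mode v (- 1) w) (A + B)"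
  unfolding leads_def
proof (intro conjI allI impI)
  show "coord (heis_mode v (- 1) w) (A + B) \<noteq> 0"
    using assms by (subst coord_heis_mode_leading[OF assms]) (auto simp: leads_def)
next
  fix X assume nz: "coord (heis_mode v (- 1) w) X \<noteq> 0"
  have "X = A + B" if "size X > size (A + B) \<or> size X = size (A + B) \<and> X \<ge> A + B"
    using coord_heis_mode_leading[OF assms that] nz by (simp split: if_splits)
  \<comment> \<open>Totality of the multiset order: whatever is not at or above \<open>A + B\<close>
    lies below it.\<close>
  moreover have "X \<le> A + B \<or> A + B \<le> X" by (rule linear)
  ultimately show "size X < size (A + B) \<or> size X = size (A + B) \<and> X \<le> A + B"
    by (metis linorder_neqE_nat order_refl)
qed

lemma leads_vac: "leads vac {#}"
  using coord_hmon[of "[]"] by (auto simp: leads_def hmon_def positive_def)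

lemma leads_iter_mode:
  assumes "leads v A"
  shows "leads (iter_mode heis_mode v (replicate t (- 1)) vac) (repeat_mset t A)"
  unfolding iter_mode_def
  by (induction t) (auto simp: leads_vac intro: leads_heis_mode[OF assms])

section \<open>The vacuum, the zero vector and the inclusion of the radicals\<close>

lemma heis_mode_vac: "heis_mode vac (- 1) w = w"
proof -
  have "heis_mode vac = nop_mode []"
    using is_heis_mode by (auto simp: is_heis_mode_def hmon_def positive_def dest!: spec[of _ "[]"])
  moreover have "nop_mode [] (- 1) w = w"
  proof -
    \<comment> \<open>For \<open>w = 0\<close> the term of the empty list vanishes and leaves the
      support; the sum is \<open>w\<close> in both cases.\<close>
    have "nop_support [] (- 1) w = (if w = 0 then {} else {[]})"
      by (auto simp: nop_support_def nop_term_def normal_order_def)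
    then show ?thesis by (simp add: nop_mode_def nop_term_def normal_order_def)
  qed
  ultimately show ?thesis by simp
qed

lemma heis_mode_zero_left: "heis_mode 0 p w = 0"
  by (subst heis_mode_expansion) simp

lemma heis_mode_zero_right: "heis_mode b p 0 = 0"
proof -
  have "heis_mode (mon_of A) p 0 = 0" if A: "coord b A \<noteq> 0" for A
  proof -
    obtain ns where "heis_mode (mon_of A) = nop_mode ns"
      using heis_mode_mon_of[OF coord_pos[OF A]] by metis
    then show ?thesis by (simp add: nop_mode_def nop_term_def foldr_alpha_zero)
  qed
  then show ?thesis by (subst heis_mode_expansion) simp
qed

lemma iter_mode_zero: "ns \<noteq> [] \<Longrightarrow> iter_mode heis_mode 0 ns w = 0"
  by (cases ns) (simp_all add: iter_mode_def heis_mode_zero_left)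

text \<open>The bound 1 serves on both sides: every nonempty iterate of \<open>0\<close> is
  \<open>0\<close>, whereas the empty one is \<open>one\<close>.\<close>

lemma zero_in_strong_radical:
  assumes "heis.subspace M"
  shows "0 \<in> strong_radical heis_mode one M"
proof -
  have zero: "iter_mode heis_mode 0 ns one = 0" if "length ns \<ge> 1" for ns
    using that by (intro iter_mode_zero) auto
  have "0 \<in> M" by (rule heis.subspace_0[OF assms])
  then show ?thesis
    unfolding strong_radical_def left_strong_radical_def right_strong_radical_def
    by (auto intro!: exI[of _ 1] simp: zero heis_mode_zero_left heis_mode_zero_right
      simp del: One_nat_def)
qed

text \<open>The left strong radical allows \<open>b = vac\<close> and \<open>s = -1\<close>, which
  is the identity operator.\<close>

lemma strong_radical_subset_radical: "strong_radical heis_mode one M \<subseteq> radical heis_mode one M"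
proof
  fix v assume "v \<in> strong_radical heis_mode one M"
  then obtain m where "m \<ge> 1"
    and m: "\<And>ns b s. length ns \<ge> m \<Longrightarrow> heis_mode b s (iter_mode heis_mode v ns one) \<in> M"
    unfolding strong_radical_def left_strong_radical_def by auto
  with m[where b = vac and s = "- 1"] show "v \<in> radical heis_mode one M"
    by (auto simp: radical_def heis_mode_vac)
qed

section \<open>Vanishing of the radical\<close>

lemma radical_eq_zero:
  assumes "k > 0" and M: "\<And>v A. v \<in> M \<Longrightarrow> k dvd size A \<Longrightarrow> coord v A = 0"
  shows "radical heis_mode vac M \<subseteq> {0}"
proof
  fix v assume "v \<in> radical heis_mode vac M"
  then obtain m where m: "\<And>ns. length ns \<ge> m \<Longrightarrow> iter_mode heis_mode v ns vac \<in> M"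
    unfolding radical_def by auto
  show "v \<in> {0}"
  proof (rule ccontr)
    assume "v \<notin> {0}"
    then obtain A where A: "leads v A" using ex_leads by auto
    \<comment> \<open>The count \<open>k * m\<close> is at least \<open>m\<close>, so
      \<open>?u\<close> lies in \<open>M\<close>, and it is a multiple of \<open>k\<close>, so the
      leading monomial of \<open>?u\<close> has length divisible by \<open>k\<close>.\<close>
    let ?u = "iter_mode heis_mode v (replicate (k * m) (- 1)) vac"
    have "?u \<in> M" using \<open>k > 0\<close> by (intro m) simp
    then have "coord ?u (repeat_mset (k * m) A) = 0" by (rule M) simp
    then show False using leads_iter_mode[OF A, of "k * m"] by (simp add: leads_def)
  qed
qed

text \<open>No element of \<open>L\<close> is 0 modulo \<open>k\<close>, so a length divisible by
  \<open>k\<close> matches none of the summands.\<close>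

lemma coord_span_residue_spaces:
  assumes "L \<subseteq> {1..k - 1}" and "v \<in> heis.span (\<Union>l\<in>L. residue_space k l)" and "k dvd int (size A)"
  shows "coord v A = 0"
  using assms(2)
proof (induction rule: heis.span_induct_alt)
  case (step c x y)
  then obtain l where l: "l \<in> L" "x \<in> residue_space k l" by blast
  then have "0 < l" "l < k" using assms(1) by force+
  then have "l mod k \<noteq> 0" by simp
  then have "coord x A = 0" using l assms(3) unfolding residue_space_coord by (metis dvd_imp_mod_0)
  with step.IH show ?case by (simp add: coord_add coord_hscale)
qed simp

theorem corollary47:
  fixes k :: int and L :: "int set"
  assumes "k > 1"
    and "L \<subseteq> {1..k - 1}"
  shows "mathieu_zhao hscale heis_mode vac (heis.span (\<Union>l\<in>L. residue_space k l))"
proof -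
  let ?M = "heis.span (\<Union>l\<in>L. residue_space k l)"
  have "radical heis_mode vac ?M \<subseteq> {0}"
  proof (rule radical_eq_zero)
    show "nat k > 0" using assms(1) by simp
    fix v and A :: "nat multiset" assume "v \<in> ?M" "nat k dvd size A"
    then show "coord v A = 0"
      using assms(1) by (intro coord_span_residue_spaces[OF assms(2)]) (auto simp: nat_dvd_iff)
  qed
  \<comment> \<open>The strong radical contains 0 and lies in the radical, which is contained in
    {0}; so both are {0}.\<close>
  then have "radical heis_mode vac ?M = strong_radical heis_mode vac ?M"
    using zero_in_strong_radical[OF heis.subspace_span] strong_radical_subset_radical by blast
  then show ?thesis by (simp add: mathieu_zhao_def heis.subspace_span)
qed

end
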